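(* If $(X,\to,0,1)$ is a quantum-Wajsberg algebra, then every deductive system of $X$ is commutative, i.e. $\mathcal{DS}(X)=\mathcal{DS}_c(X)$.
   Context: A BE algebra is an algebra $(X,\to,1)$ of type $(2,0)$ such that for all $x,y,z\in X$: $x\to x=1$; $x\to 1=1$; $1\to x=x$; $x\to(y\to z)=y\to(x\to z)$. Put $x\le y$ iff $x\to y=1$. It is bounded if there is $0\in X$ with $0\le x$ for all $x\in X$; then $x^*:=x\to 0$. It is involutive if it is bounded and $x^{**}=x$ for all $x$. In an involutive BE algebra $(X,\to,0,1)$ define $x\Cup y:=(x\to y)\to y$ and $x\Cap y:=((x^*\to y^* )\to y^* )^*$. A quantum-Wajsberg algebra is an involutive BE algebra satisfying $x\to ((x\Cap y)\Cap (z\Cap x))=(x\to y)\Cap (x\to z)$ for all $x,y,z\in X$; equivalently, satisfying both $x\to(x\Cap y)=x\to y$ and $x\to (y\Cap (z\Cap x))=(x\to y)\Cap (x\to z)$ for all $x,y,z\in X$. A deductive system of $X$ is a subset $F\subseteq X$ with $1\in F$ and such that $x,\,x\to y\in F$ implies $y\in F$. A deductive system $F$ is commutative if for all $x,y\in X$, $y\to x\in F$ implies $(x\Cup y)\to x\in F$. $\mathcal{DS}(X)$ is the set of all deductive systems of $X$ and $\mathcal{DS}_c(X)$ the set of all commutative deductive systems of $X$. *)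

theory Defs
  imports Main
begin

(* All structures live on an explicit carrier X; the axioms only constrain the operations on X. *)

locale be_algebra =
  fixes X :: "'a set"
    and imp :: "'a \<Rightarrow> 'a \<Rightarrow> 'a"  (infixr "\<rightarrow>" 65)
    and one :: 'a  ("\<one>")
  assumes imp_closed: "\<lbrakk>x \<in> X; y \<in> X\<rbrakk> \<Longrightarrow> x \<rightarrow> y \<in> X"
    and one_closed: "\<one> \<in> X"
    and imp_refl: "x \<in> X \<Longrightarrow> x \<rightarrow> x = \<one>"
    and imp_one: "x \<in> X \<Longrightarrow> x \<rightarrow> \<one> = \<one>"
    and one_imp: "x \<in> X \<Longrightarrow> \<one> \<rightarrow> x = x"
    and imp_exchange:
      "\<lbrakk>x \<in> X; y \<in> X; z \<in> X\<rbrakk> \<Longrightarrow> x \<rightarrow> (y \<rightarrow> z) = y \<rightarrow> (x \<rightarrow> z)"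
begin

definition le :: "'a \<Rightarrow> 'a \<Rightarrow> bool"  (infix "\<preceq>" 50) where
  "x \<preceq> y \<longleftrightarrow> x \<rightarrow> y = \<one>"

definition cup :: "'a \<Rightarrow> 'a \<Rightarrow> 'a"  (infixl "\<Cup>" 70) where
  "x \<Cup> y = (x \<rightarrow> y) \<rightarrow> y"

definition deductive_system :: "'a set \<Rightarrow> bool" where
  "deductive_system F \<longleftrightarrow> F \<subseteq> X \<and> \<one> \<in> F \<and>
     (\<forall>x\<in>X. \<forall>y\<in>X. x \<in> F \<longrightarrow> x \<rightarrow> y \<in> F \<longrightarrow> y \<in> F)"

definition commutative_deductive_system :: "'a set \<Rightarrow> bool" where
  "commutative_deductive_system F \<longleftrightarrow> deductive_system F \<and>
     (\<forall>x\<in>X. \<forall>y\<in>X. y \<rightarrow> x \<in> F \<longrightarrow> (x \<Cup> y) \<rightarrow> x \<in> F)"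

definition DS :: "'a set set" where
  "DS = {F. deductive_system F}"

definition DSc :: "'a set set" where
  "DSc = {F. commutative_deductive_system F}"

end

locale bounded_be_algebra = be_algebra X imp one
  for X :: "'a set" and imp (infixr "\<rightarrow>" 65)
    and zero :: 'a  ("\<zero>") and one ("\<one>") +
  assumes zero_closed: "\<zero> \<in> X"
    and zero_le: "x \<in> X \<Longrightarrow> \<zero> \<preceq> x"
begin

definition star :: "'a \<Rightarrow> 'a"  ("_\<^sup>\<star>" [1000] 999) where
  "x\<^sup>\<star> = x \<rightarrow> \<zero>"

definition cap :: "'a \<Rightarrow> 'a \<Rightarrow> 'a"  (infixl "\<Cap>" 70) where
  "x \<Cap> y = ((x\<^sup>\<star> \<rightarrow> y\<^sup>\<star>) \<rightarrow> y\<^sup>\<star>)\<^sup>\<star>"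

end

locale involutive_be_algebra = bounded_be_algebra +
  assumes star_star: "x \<in> X \<Longrightarrow> (x\<^sup>\<star>)\<^sup>\<star> = x"

locale quantum_wajsberg_algebra = involutive_be_algebra +
  assumes quantum_wajsberg:
    "\<lbrakk>x \<in> X; y \<in> X; z \<in> X\<rbrakk> \<Longrightarrow>
       x \<rightarrow> ((x \<Cap> y) \<Cap> (z \<Cap> x)) = (x \<rightarrow> y) \<Cap> (x \<rightarrow> z)"

end

theory Submission
  imports Defs
begin

text \<open>
  The theorem rests on the identity \<open>(x \<Cup> y) \<rightarrow> x = y \<rightarrow> x\<close>: with it, the condition that makes a
  deductive system commutative is a tautology. Contraposition turns the identity into
  \<open>x\<^sup>\<star> \<rightarrow> (x\<^sup>\<star> \<Cap> y\<^sup>\<star>) = x\<^sup>\<star> \<rightarrow> y\<^sup>\<star>\<close>, an instance of the law \<open>x \<rightarrow> (x \<Cap> y) = x \<rightarrow> y\<close>.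

  That law follows from two specialisations of the quantum-Wajsberg axiom. Putting \<open>y = \<one>\<close> gives
  the mirrored law \<open>x \<rightarrow> (z \<Cap> x) = x \<rightarrow> z\<close>, because \<open>z \<Cap> x\<close> lies below \<open>x\<close> and is therefore
  absorbed in \<open>x \<Cap> (z \<Cap> x)\<close>. Putting \<open>z = \<one>\<close> gives \<open>x \<rightarrow> ((x \<Cap> y) \<Cap> x) = x \<rightarrow> y\<close>, whose left
  side is \<open>x \<rightarrow> (x \<Cap> y)\<close> by the mirrored law. The detour is needed because \<open>\<Cap>\<close> is not
  commutative and \<open>x \<Cap> y\<close> need not lie below \<open>x\<close>.
\<close>

context involutive_be_algebra
begin

lemma star_closed: "x \<in> X \<Longrightarrow> x\<^sup>\<star> \<in> X"
  by (simp add: star_def imp_closed zero_closed)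

lemma cup_closed: "\<lbrakk>x \<in> X; y \<in> X\<rbrakk> \<Longrightarrow> x \<Cup> y \<in> X"
  by (simp add: cup_def imp_closed)

lemma cap_closed: "\<lbrakk>x \<in> X; y \<in> X\<rbrakk> \<Longrightarrow> x \<Cap> y \<in> X"
  by (simp add: cap_def imp_closed star_closed)

lemma one_star: "\<one>\<^sup>\<star> = \<zero>"
  by (simp add: star_def one_imp zero_closed)

lemma contraposition:
  assumes "x \<in> X" "y \<in> X"
  shows "x\<^sup>\<star> \<rightarrow> y\<^sup>\<star> = y \<rightarrow> x"
proof -
  have "x\<^sup>\<star> \<rightarrow> y\<^sup>\<star> = y \<rightarrow> (x\<^sup>\<star>)\<^sup>\<star>"
    using imp_exchange[OF star_closed[OF assms(1)] assms(2) zero_closed]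
    by (simp add: star_def)
  then show ?thesis
    by (simp add: star_star assms)
qed

lemma cup_star: "\<lbrakk>x \<in> X; y \<in> X\<rbrakk> \<Longrightarrow> (x \<Cup> y)\<^sup>\<star> = x\<^sup>\<star> \<Cap> y\<^sup>\<star>"
  by (simp add: cap_def cup_def star_star)

lemma one_cap: "x \<in> X \<Longrightarrow> \<one> \<Cap> x = x"
  using zero_le[of "x\<^sup>\<star>"]
  by (simp add: cap_def le_def one_star star_closed one_imp star_star)

lemma cap_one:
  assumes "x \<in> X"
  shows "x \<Cap> \<one> = x"
proof -
  have "x \<Cap> \<one> = (((x\<^sup>\<star>)\<^sup>\<star>)\<^sup>\<star>)\<^sup>\<star>"
    unfolding cap_def one_star by (simp add: star_def)
  then show ?thesis
    by (simp add: star_star assms)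
qed

lemma cap_le_right:
  assumes "x \<in> X" "y \<in> X"
  shows "x \<Cap> y \<preceq> y"
proof -
  define u where "u = x\<^sup>\<star> \<rightarrow> y\<^sup>\<star>"
  have u: "u \<in> X" and y: "y\<^sup>\<star> \<in> X"
    by (simp_all add: u_def assms imp_closed star_closed)
  have "x \<Cap> y \<rightarrow> y = y\<^sup>\<star> \<rightarrow> (x \<Cap> y)\<^sup>\<star>"
    using contraposition[of y "x \<Cap> y"] assms cap_closed by simp
  also have "\<dots> = y\<^sup>\<star> \<rightarrow> (u \<rightarrow> y\<^sup>\<star>)"
    by (simp add: cap_def u_def star_star imp_closed star_closed assms)
  also have "\<dots> = u \<rightarrow> (y\<^sup>\<star> \<rightarrow> y\<^sup>\<star>)"
    using imp_exchange y u by blast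
  also have "\<dots> = \<one>"
    using u y by (simp add: imp_refl imp_one)
  finally show ?thesis
    by (simp add: le_def)
qed

lemma cap_absorb_le:
  assumes "x \<in> X" "y \<in> X" "x \<preceq> y"
  shows "y \<Cap> x = x"
proof -
  have "y\<^sup>\<star> \<rightarrow> x\<^sup>\<star> = \<one>"
    using assms contraposition by (simp add: le_def)
  then show ?thesis
    by (simp add: cap_def one_imp star_closed star_star assms)
qed

end

context quantum_wajsberg_algebra
begin

text \<open>The axiom with its middle variable set to \<open>\<one>\<close> reads
  \<open>x \<rightarrow> (x \<Cap> (z \<Cap> x)) = x \<rightarrow> z\<close>, and \<open>x \<Cap> (z \<Cap> x)\<close> collapses since \<open>z \<Cap> x \<preceq> x\<close>.\<close>

lemma imp_cap_right:
  assumes "x \<in> X" "z \<in> X"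
  shows "x \<rightarrow> (z \<Cap> x) = x \<rightarrow> z"
proof -
  have "x \<Cap> (z \<Cap> x) = z \<Cap> x"
    using assms cap_closed cap_le_right cap_absorb_le by simp
  then show ?thesis
    using quantum_wajsberg[OF assms(1) one_closed assms(2)] assms
    by (simp add: cap_one imp_one one_cap imp_closed)
qed

text \<open>The extra factor \<open>x\<close> on the right of \<open>(x \<Cap> y) \<Cap> x\<close> is invisible under \<open>x \<rightarrow> _\<close> by the
  previous lemma, and the axiom with last variable \<open>\<one>\<close> evaluates the result.\<close>

lemma imp_cap_left:
  assumes "x \<in> X" "y \<in> X"
  shows "x \<rightarrow> (x \<Cap> y) = x \<rightarrow> y"
proof -
  have "x \<rightarrow> (x \<Cap> y) = x \<rightarrow> ((x \<Cap> y) \<Cap> x)"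
    using imp_cap_right assms cap_closed by simp
  also have "\<dots> = x \<rightarrow> y"
    using quantum_wajsberg[OF assms one_closed] assms
    by (simp add: cap_one imp_one one_cap imp_closed)
  finally show ?thesis .
qed

lemma cup_imp_left:
  assumes "x \<in> X" "y \<in> X"
  shows "(x \<Cup> y) \<rightarrow> x = y \<rightarrow> x"
proof -
  have "(x \<Cup> y) \<rightarrow> x = x\<^sup>\<star> \<rightarrow> (x \<Cup> y)\<^sup>\<star>"
    using contraposition assms cup_closed by simp
  also have "\<dots> = x\<^sup>\<star> \<rightarrow> y\<^sup>\<star>"
    using imp_cap_left assms by (simp add: cup_star star_closed)
  also have "\<dots> = y \<rightarrow> x"
    using contraposition assms by simp
  finally show ?thesis .
qed

lemma deductive_system_commutative:
  "deductive_system F \<Longrightarrow> commutative_deductive_system F"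
  by (simp add: commutative_deductive_system_def cup_imp_left)

lemma DS_eq_DSc: "DS = DSc"
  unfolding DS_def DSc_def
  using deductive_system_commutative commutative_deductive_system_def by auto

end

theorem proposition4p16:
  fixes X :: "'a set" and imp :: "'a \<Rightarrow> 'a \<Rightarrow> 'a" and zero one :: 'a
  assumes "quantum_wajsberg_algebra X imp zero one"
  shows "(\<forall>F. be_algebra.deductive_system X imp one F \<longrightarrow>
              be_algebra.commutative_deductive_system X imp one F) \<and>
         be_algebra.DS X imp one = be_algebra.DSc X imp one"
proof -
  interpret quantum_wajsberg_algebra X imp zero one
    by (rule assms)
  show ?thesis
    using deductive_system_commutative DS_eq_DSc by blast
qed

end
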